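(* Let $f:\mathbb{R}^n\to\mathbb{R}$ be convex and specularly Fréchet differentiable in $\mathbb{R}^n$. Let $\{t_k\}_{k=0}^\infty$ be a sequence of real numbers with $t_k>0$ for all $k$, $$\sum_{k=0}^\infty t_k=\infty \qquad\text{and}\qquad \sum_{k=0}^\infty t_k^2<\infty .$$ Let $\mathbf{x}_0\in\mathbb{R}^n$ and let $\{\mathbf{x}_k\}_{k=0}^\infty$ be the sequence generated by the specular gradient method $$\mathbf{x}_{k+1}=\mathbf{x}_k-h_k\,\blacktriangledown f(\mathbf{x}_k),\qquad k\in\mathbb{N}\cup\{0\},$$ with the step size $$h_k=\begin{cases}\dfrac{t_k}{\|\blacktriangledown f(\mathbf{x}_k)\|} & \text{if } \|\blacktriangledown f(\mathbf{x}_k)\|\neq 0,\\[1ex] 0 & \text{if } \|\blacktriangledown f(\mathbf{x}_k)\|=0.\end{cases}$$ Then the following statements hold. (a) If $\blacktriangledown f(\mathbf{x}_\kappa)=0$ for some $\kappa\in\mathbb{N}\cup\{0\}$, then $\mathbf{x}_\kappa$ is a minimizer of $f$. (b) If $\blacktriangledown f(\mathbf{x}_k)\neq 0$ for all $k\in\mathbb{N}\cup\{0\}$ and there exists a minimizer of $f$, then $\{\mathbf{x}_k\}_{k=0}^\infty$ converges to one of the minimizers of $f$.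
   Context: $\|\cdot\|$ is the Euclidean norm (on $\mathbb{R}^n$ or $\mathbb{R}^{n+1}$) and $\cdot$ is the dot product. "Minimizer of $f$" means a global minimizer over $\mathbb{R}^n$. Specular Fréchet differentiability: for $\Omega\subset\mathbb{R}^n$ open, $f:\Omega\to\mathbb{R}$ is specularly Fréchet differentiable at $\mathbf{x}\in\Omega$ if there exists a continuous linear $\ell:\mathbb{R}^n\to\mathbb{R}$ such that $$\lim_{\|\mathbf{w}\|\to 0}\left|\frac{f(\mathbf{x}+\mathbf{w})-f(\mathbf{x})-\ell(\mathbf{w})}{\|\mathbf{w}\|}\cdot\frac{\|J\|}{\|J\|+\|K\|}+\frac{f(\mathbf{x})-f(\mathbf{x}-\mathbf{w})-\ell(\mathbf{w})}{\|\mathbf{w}\|}\cdot\frac{\|K\|}{\|J\|+\|K\|}\right|=0,$$ where $J:=(\mathbf{w},f(\mathbf{x})-f(\mathbf{x}-\mathbf{w}))$ and $K:=(\mathbf{w},f(\mathbf{x}+\mathbf{w})-f(\mathbf{x}))$ in $\mathbb{R}^{n+1}$. Such an $\ell$ is unique if it exists; it is denoted $\widehat{D}f(\mathbf{x})$. The specular gradient $\blacktriangledown f(\mathbf{x})\in\mathbb{R}^n$ is the unique vector with $\widehat{D}f(\mathbf{x})(\mathbf{w})=\blacktriangledown f(\mathbf{x})\cdot\mathbf{w}$ for all $\mathbf{w}\in\mathbb{R}^n$. "In $\mathbb{R}^n$" means at every point of $\mathbb{R}^n$. *)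

theory Defs
  imports "HOL-Analysis.Analysis"
begin

text \<open>
  The limit at \<^term>\<open>0\<close> only involves the values of \<^term>\<open>f\<close> near \<^term>\<open>x\<close>, so for a function
  on an open set \<open>\<Omega>\<close> containing \<^term>\<open>x\<close> it does not depend on how the function is extended
  outside \<open>\<Omega>\<close>. The norm on \<^typ>\<open>'a \<times> real\<close> is the Euclidean norm on the product, so
  \<open>J\<close> and \<open>K\<close> below are measured as vectors of the (n+1)-dimensional Euclidean space.
\<close>

definition has_specular_derivative ::
    "('a::euclidean_space \<Rightarrow> real) \<Rightarrow> ('a \<Rightarrow> real) \<Rightarrow> 'a \<Rightarrow> bool" where
  "has_specular_derivative f l x \<longleftrightarrow> bounded_linear l \<and>
     ((\<lambda>w. let J = (w, f x - f (x - w)); K = (w, f (x + w) - f x) in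
        \<bar>(f (x + w) - f x - l w) / norm w * (norm J / (norm J + norm K)) +
         (f x - f (x - w) - l w) / norm w * (norm K / (norm J + norm K))\<bar>) \<longlongrightarrow> 0) (at 0)"

definition specularly_differentiable :: "('a::euclidean_space \<Rightarrow> real) \<Rightarrow> 'a \<Rightarrow> bool" where
  "specularly_differentiable f x \<longleftrightarrow> (\<exists>l. has_specular_derivative f l x)"

definition specular_derivative :: "('a::euclidean_space \<Rightarrow> real) \<Rightarrow> 'a \<Rightarrow> 'a \<Rightarrow> real" where
  "specular_derivative f x = (THE l. has_specular_derivative f l x)"

definition specular_gradient :: "('a::euclidean_space \<Rightarrow> real) \<Rightarrow> 'a \<Rightarrow> 'a" where
  "specular_gradient f x = (THE v. \<forall>w. specular_derivative f x w = v \<bullet> w)"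

lemma has_specular_derivative_unique:
  assumes "has_specular_derivative f l x" "has_specular_derivative f m x"
  shows "l = m"
proof -
  let ?J = "\<lambda>w. norm (w, f x - f (x - w))" and ?K = "\<lambda>w. norm (w, f (x + w) - f x)"
  let ?q = "\<lambda>l w. (f (x + w) - f x - l w) / norm w * (?J w / (?J w + ?K w)) +
                  (f x - f (x - w) - l w) / norm w * (?K w / (?J w + ?K w))"
  define d where "d = (\<lambda>w. m w - l w)"
  have bl: "bounded_linear l" "bounded_linear m" and
    lim: "(?q l \<longlongrightarrow> 0) (at 0)" "(?q m \<longlongrightarrow> 0) (at 0)"
    using assms unfolding has_specular_derivative_def Let_def by (auto dest: tendsto_rabs_zero_cancel)
  have bd: "bounded_linear d"
    unfolding d_def by (intro bounded_linear_sub bl)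
  have alg: "((a - r) / c * p + (b - r) / c * q) - ((a - s) / c * p + (b - s) / c * q)
      = (s - r) / c * (p + q)" for a b c p q r s :: real
    by (simp add: divide_inverse algebra_simps)
  have eq: "?q l w - ?q m w = d w / norm w" if "w \<noteq> 0" for w
  proof -
    have s: "?J w + ?K w > 0"
      using that by (intro add_pos_pos) (auto simp: zero_prod_def)
    have "?q l w - ?q m w = d w / norm w * (?J w / (?J w + ?K w) + ?K w / (?J w + ?K w))"
      unfolding d_def by (rule alg)
    also have "?J w / (?J w + ?K w) + ?K w / (?J w + ?K w) = 1"
      using s by (simp flip: add_divide_distrib)
    finally show ?thesis by (simp only: mult_1_right)
  qed
  have "((\<lambda>w. ?q l w - ?q m w) \<longlongrightarrow> 0 - 0) (at 0)"
    by (intro tendsto_diff lim)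
  then have "((\<lambda>w. ?q l w - ?q m w) \<longlongrightarrow> 0) (at 0)"
    by (simp only: diff_0_right)
  moreover have "\<forall>\<^sub>F w in at 0. ?q l w - ?q m w = d w / norm w"
    unfolding eventually_at_filter by (rule always_eventually) (use eq in blast)
  ultimately have "((\<lambda>w. d w / norm w) \<longlongrightarrow> 0) (at 0)"
    by (rule Lim_transform_eventually)
  then have "((\<lambda>w. norm (d w) / norm w) \<longlongrightarrow> 0) (at 0)"
    using tendsto_rabs_zero by fastforce
  then have "(d has_derivative (\<lambda>_. 0)) (at 0)"
    using bd by (simp add: has_derivative_at bounded_linear.linear linear_0)
  moreover have "(d has_derivative d) (at 0)"
    using bd by (rule bounded_linear_imp_has_derivative)
  ultimately have "d = (\<lambda>_. 0)"
    by (rule has_derivative_unique[symmetric])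
  then show ?thesis
    by (simp add: d_def fun_eq_iff)
qed

lemma has_specular_derivative_gradient:
  assumes "specularly_differentiable f x"
  shows "has_specular_derivative f (\<lambda>w. specular_gradient f x \<bullet> w) x"
proof -
  have d: "has_specular_derivative f (specular_derivative f x) x"
  proof -
    obtain l where l: "has_specular_derivative f l x"
      using assms unfolding specularly_differentiable_def ..
    show ?thesis
      unfolding specular_derivative_def
      by (rule theI[where P = "\<lambda>l. has_specular_derivative f l x", OF l]) (rule has_specular_derivative_unique[OF _ l])
  qed
  then have lin: "linear (specular_derivative f x)"
    by (simp add: has_specular_derivative_def bounded_linear.linear)
  let ?v = "adjoint (specular_derivative f x) 1"
  have "\<forall>w. specular_derivative f x w = ?v \<bullet> w"
    using adjoint_works[OF lin, of _ 1] by (simp add: inner_commute)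
  then have "\<exists>!v. \<forall>w. specular_derivative f x w = v \<bullet> w"
  proof (intro ex1I[of _ ?v] allI)
    fix v assume "\<forall>w. specular_derivative f x w = v \<bullet> w"
    then have "\<forall>w. v \<bullet> w = ?v \<bullet> w"
      using \<open>\<forall>w. specular_derivative f x w = ?v \<bullet> w\<close> by simp
    then show "v = ?v" by (simp add: vector_eq_rdot)
  qed blast
  then have "\<forall>w. specular_derivative f x w = specular_gradient f x \<bullet> w"
    unfolding specular_gradient_def by (rule theI')
  then have "specular_derivative f x = (\<lambda>w. specular_gradient f x \<bullet> w)" by auto
  with d show ?thesis by simp
qed

end

theory Submission
  imports Defs
begin

text \<open>
  For convex \<open>f\<close>, the backward difference quotient of \<open>f\<close> at a point is at most the forward one, so
  their weighted mean in the definition of the specular derivative is at most the forward quotient,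
  which decreases along rays towards the point. Passing to the limit shows that the specular gradient
  is a subgradient. The method is therefore a normalized subgradient method: for a minimizer \<open>z\<close>,
  the squares \<open>\<parallel>x\<^sub>k - z\<parallel>\<^sup>2\<close> decrease up to the summable errors \<open>t\<^sub>k\<^sup>2\<close> and hence converge, the
  subgradients along the bounded orbit are bounded, and so \<open>\<Sum> t\<^sub>k (f(x\<^sub>k) - f(z))\<close> converges. As \<open>\<Sum> t\<^sub>k\<close>
  diverges, some cluster point of the orbit is a minimizer, and the distances to it tend to \<open>0\<close>.
\<close>

lemma convex_has_specular_derivative_subgradient:
  fixes f :: "'a::euclidean_space \<Rightarrow> real"
  assumes convex: "convex_on UNIV f" and der: "has_specular_derivative f l x"
  shows "f x + l w \<le> f (x + w)"
proof (cases "w = 0")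
  case True
  have "bounded_linear l"
    using der by (simp add: has_specular_derivative_def)
  with True show ?thesis
    by (simp add: bounded_linear.linear linear_0)
next
  case False
  let ?J = "\<lambda>w. norm (w, f x - f (x - w))" and ?K = "\<lambda>w. norm (w, f (x + w) - f x)"
  let ?q = "\<lambda>w. (f (x + w) - f x - l w) / norm w * (?J w / (?J w + ?K w)) +
                  (f x - f (x - w) - l w) / norm w * (?K w / (?J w + ?K w))"
  have lin: "linear l" and lim: "(?q \<longlongrightarrow> 0) (at 0)"
    using der unfolding has_specular_derivative_def Let_def
    by (auto dest: tendsto_rabs_zero_cancel bounded_linear.linear)
  \<comment> \<open>Restricting the limit to the ray through \<open>w\<close> turns it into a
    one-sided limit in the scalar \<open>s\<close>.\<close>
  have "filterlim (\<lambda>s. s *\<^sub>R w) (at 0) (at_right (0::real))"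
    unfolding filterlim_at
  proof
    show "\<forall>\<^sub>F s in at_right (0::real). s *\<^sub>R w \<in> UNIV \<and> s *\<^sub>R w \<noteq> 0"
      using False by (auto simp: eventually_at_filter)
    have "((\<lambda>s. s *\<^sub>R w) \<longlongrightarrow> 0 *\<^sub>R w) (at_right (0::real))"
      by (intro tendsto_intros)
    then show "((\<lambda>s. s *\<^sub>R w) \<longlongrightarrow> 0) (at_right (0::real))"
      by simp
  qed
  then have lim': "((\<lambda>s. ?q (s *\<^sub>R w)) \<longlongrightarrow> 0) (at_right (0::real))"
    by (rule filterlim_compose[OF lim])
  have "\<forall>\<^sub>F s in at_right (0::real). s \<in> {0<..<1}"
    by (rule eventually_at_right_real) simp
  \<comment> \<open>The right-hand side does not depend on \<open>s\<close>, so the limit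
    \<open>0\<close> of the left-hand side is bounded by it. Taking \<open>s\<close> below
    \<open>1\<close> places \<open>x + s *\<^sub>R w\<close> on the segment from \<open>x\<close> to
    \<open>x + w\<close>, as \<open>chord\<close> requires.\<close>
  then have "\<forall>\<^sub>F s in at_right (0::real). ?q (s *\<^sub>R w) \<le> (f (x + w) - f x - l w) / norm w"
  proof eventually_elim
    case (elim s)
    then have s: "0 < s" "s < 1"
      by auto
    let ?v = "s *\<^sub>R w"
    have v: "norm ?v > 0"
      using False s by simp
    have mid: "f x \<le> (f (x + ?v) + f (x - ?v)) / 2"
    proof -
      have "f ((1 - 1/2) *\<^sub>R (x + ?v) + (1/2) *\<^sub>R (x - ?v))
          \<le> (1 - 1/2) * f (x + ?v) + (1/2) * f (x - ?v)"
        by (rule convex_onD[OF convex]) auto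
      moreover have "(1 - 1/2) *\<^sub>R (x + ?v) + (1/2) *\<^sub>R (x - ?v) = x"
        by (simp add: scaleR_right_distrib scaleR_right_diff_distrib flip: scaleR_left_distrib)
      ultimately show ?thesis
        by (simp add: field_simps)
    qed
    have chord: "f (x + ?v) - f x \<le> s * (f (x + w) - f x)"
    proof -
      have "f ((1 - s) *\<^sub>R x + s *\<^sub>R (x + w)) \<le> (1 - s) * f x + s * f (x + w)"
        by (rule convex_onD[OF convex]) (use s in auto)
      moreover have "(1 - s) *\<^sub>R x + s *\<^sub>R (x + w) = x + ?v"
        by (simp add: algebra_simps)
      ultimately show ?thesis
        by (simp add: algebra_simps)
    qed
    let ?A = "(f (x + ?v) - f x - l ?v) / norm ?v" and ?B = "(f x - f (x - ?v) - l ?v) / norm ?v"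
    let ?p = "?J ?v / (?J ?v + ?K ?v)" and ?r = "?K ?v / (?J ?v + ?K ?v)"
    have pos: "?J ?v + ?K ?v > 0"
      using v by (intro add_pos_pos) (auto simp: zero_prod_def)
    then have pr: "?r \<ge> 0" "?p + ?r = 1"
      by (simp_all flip: add_divide_distrib)
    \<comment> \<open>This is \<open>mid\<close> rearranged: the backward increment is at most the
      forward one. Since the weights are nonnegative and add up to \<open>1\<close>, the weighted
      mean is then at most \<open>?A\<close>.\<close>
    have "?B \<le> ?A"
      using mid v by (intro divide_right_mono) auto
    then have "?q ?v \<le> ?A * ?p + ?A * ?r"
      using pr by (intro add_left_mono mult_right_mono)
    also have "\<dots> = ?A * (?p + ?r)"
      by (rule distrib_left[symmetric])
    also have "\<dots> = ?A"
      by (simp only: pr mult_1_right)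
    also have "\<dots> \<le> s * (f (x + w) - f x - l w) / norm ?v"
      using chord v by (intro divide_right_mono) (auto simp: linear_scale[OF lin] algebra_simps)
    also have "\<dots> = (f (x + w) - f x - l w) / norm w"
      using s by simp
    finally show ?case .
  qed
  then have "0 \<le> (f (x + w) - f x - l w) / norm w"
    by (intro tendsto_upperbound[OF lim']) auto
  with False show ?thesis
    by (simp add: zero_le_divide_iff)
qed

corollary convex_specular_gradient_subgradient:
  fixes f :: "'a::euclidean_space \<Rightarrow> real"
  assumes "convex_on UNIV f" "specularly_differentiable f x"
  shows "f x + specular_gradient f x \<bullet> (y - x) \<le> f y"
  using convex_has_specular_derivative_subgradient
    [OF assms(1) has_specular_derivative_gradient[OF assms(2)], of "y - x"] by simp

text \<open>A unit step from \<open>x k\<close> in the direction of \<open>g k\<close> raises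
  \<open>f\<close> by at least \<open>norm (g k)\<close>, while \<open>f\<close> is bounded on a
  ball whose radius leaves room for such steps.\<close>

lemma subgradients_bounded:
  fixes f :: "'a::euclidean_space \<Rightarrow> real"
  assumes cont: "continuous_on UNIV f" and "bounded (x ` I)"
    and sub: "\<And>k y. k \<in> I \<Longrightarrow> f (x k) + g k \<bullet> (y - x k) \<le> f y"
  shows "bounded (g ` I)"
proof -
  obtain R where R: "\<And>k. k \<in> I \<Longrightarrow> norm (x k) \<le> R"
    using \<open>bounded (x ` I)\<close> unfolding bounded_iff by blast
  have "compact (f ` cball 0 (R + 1))"
    by (intro compact_continuous_image continuous_on_subset[OF cont]) auto
  then have "bounded (f ` cball 0 (R + 1))"
    by (rule compact_imp_bounded)
  then obtain M where M: "\<And>x. x \<in> cball 0 (R + 1) \<Longrightarrow> \<bar>f x\<bar> \<le> M"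
    unfolding bounded_iff real_norm_def by blast
  have "norm (g k) \<le> 2 * M" if "k \<in> I" for k
  proof -
    \<comment> \<open>Since \<open>sgn 0 = 0\<close>, this choice also covers a vanishing
      \<open>g k\<close>.\<close>
    let ?y = "x k + sgn (g k)"
    have "norm (sgn (g k)) \<le> 1"
      by (simp add: norm_sgn)
    then have "norm ?y \<le> R + 1"
      using R[OF that] norm_triangle_ineq[of "x k" "sgn (g k)"] by linarith
    then have "\<bar>f ?y\<bar> \<le> M" "\<bar>f (x k)\<bar> \<le> M"
      using R[OF that] by (auto intro!: M)
    moreover have "g k \<bullet> sgn (g k) = norm (g k)"
      by (cases "g k = 0") (simp_all add: sgn_div_norm dot_square_norm power2_eq_square)
    ultimately show ?thesis
      using sub[OF that, of ?y] by simp
  qed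
  then show ?thesis
    unfolding bounded_iff by blast
qed

text \<open>Subtracting the accumulated errors makes the sequence decreasing, and it stays bounded
  below because the errors have a finite sum.\<close>

lemma convergent_almost_decreasing:
  fixes a e :: "nat \<Rightarrow> real"
  assumes nonneg: "\<And>k. 0 \<le> a k" "\<And>k. 0 \<le> e k"
    and step: "\<And>k. a (Suc k) \<le> a k + e k" and "summable e"
  shows "convergent a"
proof -
  let ?b = "\<lambda>k. a k - (\<Sum>i<k. e i)"
  have "decseq ?b"
    using step by (intro decseq_SucI) (simp add: diff_le_eq)
  moreover have "- suminf e \<le> ?b k" for k
    using nonneg(1)[of k] sum_le_suminf[OF \<open>summable e\<close>, of "{..<k}"] nonneg(2) by simp
  ultimately obtain L where "?b \<longlonglongrightarrow> L"
    using decseq_convergent by blast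
  then have "(\<lambda>k. ?b k + (\<Sum>i<k. e i)) \<longlonglongrightarrow> L + suminf e"
    using summable_LIMSEQ[OF \<open>summable e\<close>] by (rule tendsto_add)
  then show ?thesis
    by (auto intro: convergentI)
qed

text \<open>If \<open>c\<close> stayed above \<open>\<epsilon>\<close> from \<open>N\<close> on,
  comparison with \<open>t k * c k\<close> would make \<open>t\<close> summable.\<close>

lemma weighted_summable_frequently_small:
  fixes t c :: "nat \<Rightarrow> real"
  assumes "\<And>k. 0 \<le> t k" "filterlim (\<lambda>N. \<Sum>k<N. t k) at_top sequentially"
    and "summable (\<lambda>k. t k * c k)" "0 < \<epsilon>"
  shows "\<exists>k\<ge>N. c k < \<epsilon>"
proof (rule ccontr)
  assume "\<not> ?thesis"
  then have ge: "\<epsilon> \<le> c k" if "N \<le> k" for k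
    using that by force
  have "summable (\<lambda>k. t k * \<epsilon>)"
    by (rule summable_comparison_test'[OF assms(3), of N])
      (use ge assms in \<open>auto intro!: mult_left_mono\<close>)
  then have "summable t"
    using \<open>0 < \<epsilon>\<close> summable_mult2[of "\<lambda>k. t k * \<epsilon>" "1 / \<epsilon>"] by simp
  from not_tendsto_and_filterlim_at_infinity[OF _ summable_LIMSEQ[OF this]
      filterlim_at_top_imp_at_infinity[OF assms(2)]]
  show False by simp
qed

text \<open>Stated for arbitrary nonzero subgradients \<open>g k\<close> at the iterates, which
  separates the convergence argument from specular differentiability.\<close>

theorem normalized_subgradient_method_converges:
  fixes f :: "'a::euclidean_space \<Rightarrow> real"
  assumes cont: "continuous_on UNIV f"
    and sub: "\<And>k y. f (x k) + g k \<bullet> (y - x k) \<le> f y"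
    and g_nz: "\<And>k. g k \<noteq> 0"
    and t_nonneg: "\<And>k. 0 \<le> t k"
    and t_sum: "filterlim (\<lambda>N. \<Sum>k<N. t k) at_top sequentially"
    and t_sq_sum: "summable (\<lambda>k. (t k)\<^sup>2)"
    and x_Suc: "\<And>k. x (Suc k) = x k - (t k / norm (g k)) *\<^sub>R g k"
    and min: "\<And>y. f z \<le> f y"
  shows "\<exists>z. (\<forall>y. f z \<le> f y) \<and> x \<longlonglongrightarrow> z"
proof -
  \<comment> \<open>Expand the square: normalization makes the step length exactly
    \<open>t k\<close>, which gives the error term, and the subgradient inequality controls the
    cross term.\<close>
  have step: "(norm (x (Suc k) - u))\<^sup>2 + 2 * t k * ((f (x k) - f u) / norm (g k))
      \<le> (norm (x k - u))\<^sup>2 + (t k)\<^sup>2" for k u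
  proof -
    let ?v = "(t k / norm (g k)) *\<^sub>R g k"
    have "(norm (x (Suc k) - u))\<^sup>2 = (norm ((x k - u) - ?v))\<^sup>2"
      by (simp add: x_Suc algebra_simps)
    also have "\<dots> = (norm (x k - u))\<^sup>2 - 2 * ((x k - u) \<bullet> ?v) + (norm ?v)\<^sup>2"
      using dot_norm_neg[of "x k - u" ?v] by (simp add: field_simps)
    also have "norm ?v = t k"
      using g_nz[of k] t_nonneg[of k] by simp
    also have "(x k - u) \<bullet> ?v = t k * ((g k \<bullet> (x k - u)) / norm (g k))"
      by (simp add: inner_commute)
    finally have eq: "(norm (x (Suc k) - u))\<^sup>2
        = (norm (x k - u))\<^sup>2 - 2 * (t k * ((g k \<bullet> (x k - u)) / norm (g k))) + (t k)\<^sup>2" .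
    have "f (x k) - f u \<le> g k \<bullet> (x k - u)"
      using sub[of k u] by (simp add: inner_diff_right)
    then have "t k * ((f (x k) - f u) / norm (g k)) \<le> t k * ((g k \<bullet> (x k - u)) / norm (g k))"
      using t_nonneg by (intro mult_left_mono divide_right_mono) auto
    with eq show ?thesis by simp
  qed
  \<comment> \<open>Proved for every minimizer \<open>u\<close>: it is applied first to the given
    \<open>z\<close> and later to a cluster point of the orbit.\<close>
  have conv: "convergent (\<lambda>k. (norm (x k - u))\<^sup>2)" if "\<And>y. f u \<le> f y" for u
  proof (rule convergent_almost_decreasing[OF _ _ _ t_sq_sum])
    fix k
    have "0 \<le> 2 * t k * ((f (x k) - f u) / norm (g k))"
      using t_nonneg that by simp
    with step[of k u] show "(norm (x (Suc k) - u))\<^sup>2 \<le> (norm (x k - u))\<^sup>2 + (t k)\<^sup>2"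
      by linarith
  qed auto
  have bx: "bounded (range x)"
  proof -
    have "Bseq (\<lambda>k. (norm (x k - z))\<^sup>2)"
      using conv[OF min] by (rule convergent_imp_Bseq)
    then obtain M where M: "\<And>k. (norm (x k - z))\<^sup>2 \<le> M"
      unfolding Bseq_def by auto
    then have "dist z (x k) \<le> sqrt M" for k
      by (auto simp: dist_norm norm_minus_commute intro!: real_le_rsqrt)
    then show ?thesis
      unfolding bounded_def by blast
  qed
  obtain G where G: "G > 0" "\<And>k. norm (g k) \<le> G"
  proof -
    have "bounded (range g)"
      using subgradients_bounded[OF cont bx] sub by blast
    then obtain G where "\<And>k. norm (g k) \<le> G"
      unfolding bounded_iff by blast
    then show ?thesis
      using that[of "max G 1"] by (meson le_max_iff_disj less_max_iff_disj zero_less_one)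
  qed
  \<comment> \<open>The estimate \<open>step\<close> at \<open>z\<close> telescopes. Replacing
    \<open>norm (g k)\<close> by its upper bound \<open>G\<close> removes the varying denominator
    and produces the factor \<open>G / 2\<close>.\<close>
  have sm: "summable (\<lambda>k. t k * (f (x k) - f z))"
  proof -
    let ?a = "\<lambda>k. (norm (x k - z))\<^sup>2"
    obtain L where "?a \<longlonglongrightarrow> L"
      using conv[OF min] by (auto simp: convergent_def)
    then have s: "summable (\<lambda>k. G / 2 * (?a k - ?a (Suc k) + (t k)\<^sup>2))"
      by (intro summable_mult summable_add t_sq_sum telescope_summable')
    show ?thesis
    proof (rule summable_comparison_test'[OF s])
      fix k
      have "t k * (f (x k) - f z) / G \<le> t k * (f (x k) - f z) / norm (g k)"
        using G g_nz min t_nonneg by (intro divide_left_mono mult_nonneg_nonneg mult_pos_pos) auto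
      also have "\<dots> \<le> (?a k - ?a (Suc k) + (t k)\<^sup>2) / 2"
        using step[of k z] by (simp add: mult_ac)
      finally have "t k * (f (x k) - f z) \<le> G / 2 * (?a k - ?a (Suc k) + (t k)\<^sup>2)"
        using G(1) by (simp add: field_simps)
      then show "norm (t k * (f (x k) - f z)) \<le> G / 2 * (?a k - ?a (Suc k) + (t k)\<^sup>2)"
        using min[of "x k"] t_nonneg[of k] by (simp add: abs_mult)
    qed
  qed
  \<comment> \<open>The tolerance forces the values along \<open>\<sigma>\<close> to tend to the
    minimum, and \<open>n \<le> \<sigma> n\<close> sends the indices to infinity even if
    \<open>\<sigma>\<close> is not monotone.\<close>
  have "\<forall>n. \<exists>k\<ge>n. f (x k) - f z < inverse (real (Suc n))"
    using weighted_summable_frequently_small[OF t_nonneg t_sum sm] by simp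
  then obtain \<sigma> where \<sigma>: "\<And>n. n \<le> \<sigma> n" "\<And>n. f (x (\<sigma> n)) - f z < inverse (real (Suc n))"
    by metis
  have "bounded (range (x \<circ> \<sigma>))"
    using bx by (rule bounded_subset) auto
  then obtain u r where r: "strict_mono r" and u: "((x \<circ> \<sigma>) \<circ> r) \<longlonglongrightarrow> u"
    using bounded_imp_convergent_subsequence by blast
  have "(\<lambda>n. f (x (\<sigma> n)) - f z) \<longlonglongrightarrow> 0"
    by (rule tendsto_sandwich[OF _ _ tendsto_const LIMSEQ_inverse_real_of_nat])
      (use \<sigma>(2) min in \<open>auto intro!: always_eventually less_imp_le\<close>)
  then have "(\<lambda>n. f (x (\<sigma> (r n))) - f z) \<longlonglongrightarrow> 0"
    using LIMSEQ_subseq_LIMSEQ[OF _ r] by (fastforce simp: o_def)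
  moreover have "(\<lambda>n. f (x (\<sigma> (r n)))) \<longlonglongrightarrow> f u"
    using continuous_on_tendsto_compose[OF cont u] by (simp add: o_def)
  then have "(\<lambda>n. f (x (\<sigma> (r n))) - f z) \<longlonglongrightarrow> f u - f z"
    by (intro tendsto_intros)
  ultimately have "0 = f u - f z"
    by (rule LIMSEQ_unique)
  then have min': "f u \<le> f y" for y
    using min by simp
  \<comment> \<open>The squared distances to \<open>u\<close> converge along the whole sequence, so
    the subsequence tending to \<open>u\<close> identifies their limit as \<open>0\<close>.\<close>
  obtain L where L: "(\<lambda>k. (norm (x k - u))\<^sup>2) \<longlonglongrightarrow> L"
    using conv[OF min'] by (auto simp: convergent_def)
  have "filterlim (\<lambda>n. \<sigma> (r n)) at_top sequentially"
    by (rule filterlim_at_top_mono[OF filterlim_subseq[OF r]]) (use \<sigma>(1) in auto)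
  from filterlim_compose[OF L this] have "(\<lambda>n. (norm (x (\<sigma> (r n)) - u))\<^sup>2) \<longlonglongrightarrow> L" .
  moreover have "(\<lambda>n. (norm (x (\<sigma> (r n)) - u))\<^sup>2) \<longlonglongrightarrow> (norm (u - u))\<^sup>2"
    using u by (intro tendsto_intros) (simp add: o_def)
  ultimately have "L = (norm (u - u))\<^sup>2"
    by (rule LIMSEQ_unique)
  with L have "(\<lambda>k. norm (x k - u)) \<longlonglongrightarrow> 0"
    using tendsto_real_sqrt[of "\<lambda>k. (norm (x k - u))\<^sup>2" L] by simp
  then have "x \<longlonglongrightarrow> u"
    by (simp add: tendsto_norm_zero_iff flip: Lim_null)
  with min' show ?thesis by blast
qed

theorem theorem4p2:
  fixes f :: "real ^ 'n \<Rightarrow> real"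
    and t h :: "nat \<Rightarrow> real"
    and x :: "nat \<Rightarrow> real ^ 'n" and x0 :: "real ^ 'n"
  assumes convex: "convex_on UNIV f"
    and diff: "\<forall>y. specularly_differentiable f y"
    and t_pos: "\<forall>k. t k > 0"
    and t_sum: "filterlim (\<lambda>N. \<Sum>k<N. t k) at_top sequentially"
    and t_sq_sum: "summable (\<lambda>k. (t k)\<^sup>2)"
    and x_0: "x 0 = x0"
    and x_Suc: "\<forall>k. x (Suc k) = x k - h k *\<^sub>R specular_gradient f (x k)"
    and step: "\<forall>k. h k = (if norm (specular_gradient f (x k)) \<noteq> 0
                          then t k / norm (specular_gradient f (x k)) else 0)"
  shows "(\<forall>\<kappa>. specular_gradient f (x \<kappa>) = 0 \<longrightarrow> is_arg_min f (\<lambda>y. y \<in> UNIV) (x \<kappa>)) \<and>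
         ((\<forall>k. specular_gradient f (x k) \<noteq> 0) \<and> (\<exists>z. is_arg_min f (\<lambda>y. y \<in> UNIV) z) \<longrightarrow>
           (\<exists>z. is_arg_min f (\<lambda>y. y \<in> UNIV) z \<and> x \<longlonglongrightarrow> z))"
proof (intro conjI allI impI)
  have sub: "f u + specular_gradient f u \<bullet> (y - u) \<le> f y" for u y
    using convex diff by (intro convex_specular_gradient_subgradient) auto
  {
    fix \<kappa> assume "specular_gradient f (x \<kappa>) = 0"
    then show "is_arg_min f (\<lambda>y. y \<in> UNIV) (x \<kappa>)"
      using sub[of "x \<kappa>"] by (simp add: is_arg_min_linorder)
  }
  assume *: "(\<forall>k. specular_gradient f (x k) \<noteq> 0) \<and> (\<exists>z. is_arg_min f (\<lambda>y. y \<in> UNIV) z)"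
  then obtain z where min: "\<And>y. f z \<le> f y"
    by (auto simp: is_arg_min_linorder)
  have cont: "continuous_on UNIV f"
    using convex by (intro convex_on_continuous) auto
  have t_nonneg: "0 \<le> t k" for k
    using t_pos by (simp add: less_imp_le)
  have "\<exists>z. (\<forall>y. f z \<le> f y) \<and> x \<longlonglongrightarrow> z"
  proof (rule normalized_subgradient_method_converges
      [OF cont, where g = "\<lambda>k. specular_gradient f (x k)" and t = t])
    \<comment> \<open>As no gradient vanishes in this case, \<open>h k\<close> is always given by
      the first branch of the step size rule.\<close>
    show "x (Suc k) = x k - (t k / norm (specular_gradient f (x k))) *\<^sub>R specular_gradient f (x k)" for k
      using * x_Suc[rule_format, of k] step[rule_format, of k] by simp
  qed (use * sub t_nonneg t_sum t_sq_sum min in blast)+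
  then show "\<exists>z. is_arg_min f (\<lambda>y. y \<in> UNIV) z \<and> x \<longlonglongrightarrow> z"
    by (simp add: is_arg_min_linorder)
qed

end
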